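(* Consider a system with phase space $\Omega$ and Lebesgue measure $\mu_{\rm L}$, driven from time $0$ to $\tau$ by a protocol $\lambda_t$, in contact with a heat bath of inverse temperature $\beta>0$, with time reversal as the reference dynamics, satisfying the detailed fluctuation relation stated in the context. Let $D_0,D_\tau\subset\Omega$ be measurable sets. Suppose the initial distribution of the original process is the local equilibrium state $$\mu_0(d\Gamma_0)=e^{-\beta(H(\Gamma_0,\lambda_0)-F_0)}\chi_{D_0}(\Gamma_0)\,\mu_{\rm L}(d\Gamma_0),\qquad e^{-\beta F_0}=\int_{D_0}e^{-\beta H(\Gamma,\lambda_0)}\mu_{\rm L}(d\Gamma)\in(0,\infty),$$ and the initial distribution of the time-reversed process (expressed as a distribution of the end point $\Gamma_\tau$ of the forward path) is the local equilibrium state $$\mu_0^\dagger(d\Gamma_\tau)=e^{-\beta(H(\Gamma_\tau,\lambda_\tau)-F_\tau)}\chi_{D_\tau}(\Gamma_\tau)\,\mu_{\rm L}(d\Gamma_\tau),\qquad e^{-\beta F_\tau}=\int_{D_\tau}e^{-\beta H(\Gamma,\lambda_\tau)}\mu_{\rm L}(d\Gamma)\in(0,\infty).$$ Let $\Delta F=F_\tau-F_0$ and let $W$ be the work. Then $$\langle e^{-\beta(W-\Delta F)}\chi_{D_\tau}(\Gamma_\tau)\rangle=1-\lambda_{\rm S}.$$ In particular, if $D_\tau=\Omega$, then $$\langle e^{-\beta(W-\Delta F)}\rangle=1-\lambda_{\rm S}.$$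
   Context: Paths $\Gamma=(\Gamma_t)_{0\le t\le\tau}$ take values in $\Omega$. $\mathcal{M}$ is the probability measure on paths of the original process (initial law $\mu_0$), and $\mathcal{M}^{\rm r}$ is the probability measure of the time-reversed process started from $\mu_0^\dagger$ under the time-reversed protocol, transported to forward paths by time reversal. $\mathcal{M}^{\rm r}=\mathcal{M}^{\rm r}_{\rm AC}+\mathcal{M}^{\rm r}_{\rm S}$ is the Lebesgue decomposition with respect to $\mathcal{M}$, and $\lambda_{\rm S}$ is the total mass of $\mathcal{M}^{\rm r}_{\rm S}$. $\langle\cdot\rangle$ is the average over $\mathcal{M}$; $\chi_D$ is the characteristic function of $D$; $H(\cdot,\lambda)$ is the (real-valued, measurable) Hamiltonian at parameter value $\lambda$. $Q[\Gamma]$ is the heat dissipated from the system to the bath along $\Gamma$, and the work is given by the first law $W=Q+\Delta H$ with $\Delta H=H(\Gamma_\tau,\lambda_\tau)-H(\Gamma_0,\lambda_0)$. Detailed fluctuation relation (the property of the Langevin or Hamiltonian dynamics that is used): for $\mathcal{M}$-almost every $\Gamma$, $$\frac{d\mathcal{M}^{\rm r}_{\rm AC}}{d\mathcal{M}}(\Gamma)=e^{-\beta Q[\Gamma]}\;\frac{d\mu_{\rm L,AC}}{d\mu_0}(\Gamma_0)\;\frac{d\mu^\dagger_{0,\rm AC}}{d\mu_{\rm L}}(\Gamma_\tau),$$ where $\mu_{\rm L,AC}$ is the absolutely continuous part of $\mu_{\rm L}$ with respect to $\mu_0$, and $\mu^\dagger_{0,\rm AC}$ is the absolutely continuous part of $\mu_0^\dagger$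 with respect to $\mu_{\rm L}$. *)

theory Defs
  imports "HOL-Probability.Probability"
begin

section \<open>Lebesgue decomposition and Radon--Nikodym derivatives\<close>

definition mutually_singular :: "'a measure \<Rightarrow> 'a measure \<Rightarrow> bool" where
  "mutually_singular M N \<longleftrightarrow>
     (\<exists>A\<in>sets M. emeasure M A = 0 \<and> emeasure N (space M - A) = 0)"

definition lebesgue_decomposition ::
    "'a measure \<Rightarrow> 'a measure \<Rightarrow> 'a measure \<Rightarrow> 'a measure \<Rightarrow> bool" where
  "lebesgue_decomposition M N Nac Ns \<longleftrightarrow>
     sets N = sets M \<and> sets Nac = sets M \<and> sets Ns = sets M \<and>
     absolutely_continuous M Nac \<and> mutually_singular M Ns \<and>
     (\<forall>A\<in>sets M. emeasure N A = emeasure Nac A + emeasure Ns A)"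

text \<open>
  A derivative of \<open>N\<close> with respect to \<open>M\<close> is determined only up to \<open>M\<close>-null sets.
  The library constant \<^const>\<open>RN_deriv\<close> picks one representative by choice; the following
  predicate describes all of them.
\<close>

definition is_RN_deriv :: "'a measure \<Rightarrow> 'a measure \<Rightarrow> ('a \<Rightarrow> ennreal) \<Rightarrow> bool" where
  "is_RN_deriv M N f \<longleftrightarrow> f \<in> borel_measurable M \<and> density M f = N"


section \<open>Phase space and paths\<close>

definition phase_measure :: "'a::euclidean_space set \<Rightarrow> 'a measure" where
  "phase_measure \<Omega> = restrict_space lborel \<Omega>"

text \<open>
  The \<open>\<sigma>\<close>-algebra on paths is left open: the product \<open>\<sigma>\<close>-algebra on all paths and
  the Borel \<open>\<sigma>\<close>-algebra on continuous paths are both instances. Of \<open>P\<close>, only the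
  space and the \<open>\<sigma>\<close>-algebra matter.
\<close>

definition path_space ::
    "real \<Rightarrow> 'a::euclidean_space set \<Rightarrow> (real \<Rightarrow> 'a) measure \<Rightarrow> bool" where
  "path_space \<tau> \<Omega> P \<longleftrightarrow>
     space P \<subseteq> {0..\<tau>} \<rightarrow>\<^sub>E \<Omega> \<and>
     (\<forall>t\<in>{0..\<tau>}. (\<lambda>\<Gamma>. \<Gamma> t) \<in> measurable P (phase_measure \<Omega>))"

text \<open>\<open>M\<close> is the law, on the path space \<open>P\<close>, of a process with initial distribution \<open>\<nu>\<close>.\<close>

definition process_law ::
    "'a::euclidean_space set \<Rightarrow> (real \<Rightarrow> 'a) measure \<Rightarrow> 'a measure \<Rightarrow> (real \<Rightarrow> 'a) measure \<Rightarrow> bool"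
  where
  "process_law \<Omega> P \<nu> M \<longleftrightarrow>
     prob_space M \<and> sets M = sets P \<and> distr M (phase_measure \<Omega>) (\<lambda>\<Gamma>. \<Gamma> 0) = \<nu>"


section \<open>Time reversal\<close>

text \<open>
  The involution \<open>\<theta>\<close> is the time reversal of a phase-space point: sign change of the momenta
  for underdamped or Hamiltonian dynamics, identity for overdamped dynamics.
\<close>

definition reversal_involution :: "'a::euclidean_space set \<Rightarrow> ('a \<Rightarrow> 'a) \<Rightarrow> bool" where
  "reversal_involution \<Omega> \<theta> \<longleftrightarrow>
     \<theta> \<in> measurable (phase_measure \<Omega>) (phase_measure \<Omega>) \<and> (\<forall>x\<in>\<Omega>. \<theta> (\<theta> x) = x)"

definition reverse_path :: "real \<Rightarrow> ('a \<Rightarrow> 'a) \<Rightarrow> (real \<Rightarrow> 'a) \<Rightarrow> (real \<Rightarrow> 'a)" where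
  "reverse_path \<tau> \<theta> \<Gamma> = (\<lambda>t\<in>{0..\<tau>}. \<theta> (\<Gamma> (\<tau> - t)))"

definition reverse_protocol :: "real \<Rightarrow> (real \<Rightarrow> 'l) \<Rightarrow> (real \<Rightarrow> 'l)" where
  "reverse_protocol \<tau> lam = (\<lambda>t. lam (\<tau> - t))"

text \<open>
  \<open>law p \<nu>\<close> is the path law of the dynamics driven by protocol \<open>p\<close> from initial
  distribution \<open>\<nu>\<close>. The argument \<open>\<mu>\<close> is the initial distribution of the reversed process
  written as a distribution of the end point of the forward path, so the reversed process
  itself starts from the image of \<open>\<mu>\<close> under \<open>\<theta>\<close>.
\<close>

definition reversed_initial ::
    "'a::euclidean_space set \<Rightarrow> ('a \<Rightarrow> 'a) \<Rightarrow> 'a measure \<Rightarrow> 'a measure" where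
  "reversed_initial \<Omega> \<theta> \<mu> = distr \<mu> (phase_measure \<Omega>) \<theta>"

definition reversed_law ::
    "real \<Rightarrow> 'a::euclidean_space set \<Rightarrow> (real \<Rightarrow> 'a) measure \<Rightarrow> ('a \<Rightarrow> 'a) \<Rightarrow>
     ((real \<Rightarrow> 'l) \<Rightarrow> 'a measure \<Rightarrow> (real \<Rightarrow> 'a) measure) \<Rightarrow> (real \<Rightarrow> 'l) \<Rightarrow> 'a measure \<Rightarrow>
     (real \<Rightarrow> 'a) measure" where
  "reversed_law \<tau> \<Omega> P \<theta> law lam \<mu> =
     distr (law (reverse_protocol \<tau> lam) (reversed_initial \<Omega> \<theta> \<mu>)) P (reverse_path \<tau> \<theta>)"


section \<open>Thermodynamics\<close>

definition partition_function ::
    "'a::euclidean_space set \<Rightarrow> real \<Rightarrow> ('a \<Rightarrow> real) \<Rightarrow> 'a set \<Rightarrow> ennreal" where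
  "partition_function \<Omega> \<beta> h D =
     (\<integral>\<^sup>+x\<in>D. ennreal (exp (- \<beta> * h x)) \<partial>phase_measure \<Omega>)"

definition local_equilibrium ::
    "'a::euclidean_space set \<Rightarrow> real \<Rightarrow> ('a \<Rightarrow> real) \<Rightarrow> real \<Rightarrow> 'a set \<Rightarrow> 'a measure" where
  "local_equilibrium \<Omega> \<beta> h F D =
     density (phase_measure \<Omega>) (\<lambda>x. ennreal (exp (- \<beta> * (h x - F)) * indicator D x))"

definition work ::
    "real \<Rightarrow> ('a \<Rightarrow> 'l \<Rightarrow> real) \<Rightarrow> (real \<Rightarrow> 'l) \<Rightarrow> ((real \<Rightarrow> 'a) \<Rightarrow> real) \<Rightarrow> (real \<Rightarrow> 'a) \<Rightarrow> real"
  where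
  "work \<tau> H lam Q \<Gamma> = Q \<Gamma> + (H (\<Gamma> \<tau>) (lam \<tau>) - H (\<Gamma> 0) (lam 0))"

text \<open>
  The relation is required for all representatives of the three derivatives, i.e. its validity
  \<open>M\<close>-almost everywhere must not depend on their choice. For the first two derivatives this is
  automatic when \<open>\<mu>0\<close> is the law of \<open>\<Gamma> 0\<close> under \<open>M\<close>. For the third it matters: that derivative
  is determined Lebesgue-almost everywhere but evaluated at \<open>\<Gamma> \<tau>\<close>, whose law under \<open>M\<close>
  is not assumed to be absolutely continuous with respect to Lebesgue measure.
\<close>

definition detailed_fluctuation_relation ::
    "real \<Rightarrow> real \<Rightarrow> ((real \<Rightarrow> 'a) \<Rightarrow> real) \<Rightarrow> (real \<Rightarrow> 'a) measure \<Rightarrow> (real \<Rightarrow> 'a) measure \<Rightarrow>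
     'a measure \<Rightarrow> 'a measure \<Rightarrow> 'a measure \<Rightarrow> 'a measure \<Rightarrow> bool" where
  "detailed_fluctuation_relation \<tau> \<beta> Q M Mr_ac \<mu>L \<mu>L_ac \<mu>0 \<mu>d_ac \<longleftrightarrow>
     (\<forall>f g h. is_RN_deriv M Mr_ac f \<longrightarrow> is_RN_deriv \<mu>0 \<mu>L_ac g \<longrightarrow> is_RN_deriv \<mu>L \<mu>d_ac h \<longrightarrow>
        (AE \<Gamma> in M. f \<Gamma> = ennreal (exp (- \<beta> * Q \<Gamma>)) * g (\<Gamma> 0) * h (\<Gamma> \<tau>)))"

end

theory Submission
  imports Defs
begin

text \<open>
  The three derivatives in the fluctuation relation are explicit: on \<open>D0\<close> the Lebesgue
  measure has derivative \<open>exp (\<beta> (H - F0))\<close> with respect to \<open>\<mu>0\<close>, and \<open>\<mu>d\<close> is its own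
  absolutely continuous part. Their product with \<open>exp (- \<beta> Q)\<close> is
  \<open>exp (- \<beta> (W - \<Delta>F)) \<chi>\<close>, so this function is the density of the absolutely continuous part
  of the reversed path law, whose total mass is \<open>1 - lambdaS\<close>.
\<close>

text \<open>The set \<open>A\<close> carries all of \<open>Ns\<close>, so off \<open>A\<close> the
  measures \<open>N\<close> and \<open>Nac\<close> agree, and deleting the \<open>M\<close>-null set
  \<open>A \<union> A'\<close> costs \<open>Nac\<close> nothing. The extra null set
  \<open>A'\<close> lets two decompositions be compared off one common set.\<close>

lemma lebesgue_decomposition_ac_eq:
  assumes dec: "lebesgue_decomposition M N Nac Ns"
    and A: "A \<in> sets M" "emeasure M A = 0" "emeasure Ns (space M - A) = 0"
    and A': "A' \<in> sets M" "emeasure M A' = 0"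
    and B: "B \<in> sets M"
  shows "emeasure Nac B = emeasure N (B - (A \<union> A'))"
proof -
  have sets: "sets Nac = sets M" "sets Ns = sets M"
    and ac: "absolutely_continuous M Nac"
    and sum: "\<And>C. C \<in> sets M \<Longrightarrow> emeasure N C = emeasure Nac C + emeasure Ns C"
    using dec by (auto simp: lebesgue_decomposition_def)
  have "A \<union> A' \<in> null_sets M"
    using A A' by (intro null_sets.Un) (auto simp: null_sets_def)
  then have "A \<union> A' \<in> null_sets Nac"
    using ac by (auto simp: absolutely_continuous_def)
  then have "emeasure Nac (B - (A \<union> A')) = emeasure Nac B"
    using B sets by (intro emeasure_Diff_null_set) auto
  moreover have "emeasure Ns (B - (A \<union> A')) = 0"
  proof -
    have "emeasure Ns (B - (A \<union> A')) \<le> emeasure Ns (space M - A)"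
      using A B sets sets.sets_into_space[OF B] by (intro emeasure_mono) auto
    then show ?thesis
      using A by simp
  qed
  ultimately show ?thesis
    using sum[of "B - (A \<union> A')"] A A' B by auto
qed

text \<open>Both absolutely continuous parts are \<open>N\<close> restricted to the complement of
  the same set \<open>A \<union> A'\<close>, by the preceding lemma used once in each
  direction.\<close>

lemma lebesgue_decomposition_unique:
  assumes "lebesgue_decomposition M N Nac Ns" "lebesgue_decomposition M N Nac' Ns'"
  shows "Nac = Nac'"
proof -
  obtain A where A: "A \<in> sets M" "emeasure M A = 0" "emeasure Ns (space M - A) = 0"
    using assms(1) by (auto simp: lebesgue_decomposition_def mutually_singular_def)
  obtain A' where A': "A' \<in> sets M" "emeasure M A' = 0" "emeasure Ns' (space M - A') = 0"
    using assms(2) by (auto simp: lebesgue_decomposition_def mutually_singular_def)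
  have sets: "sets Nac = sets M" "sets Nac' = sets M"
    using assms by (auto simp: lebesgue_decomposition_def)
  show ?thesis
  proof (rule measure_eqI)
    fix B assume "B \<in> sets Nac"
    then have B: "B \<in> sets M" using sets by simp
    show "emeasure Nac B = emeasure Nac' B"
      using lebesgue_decomposition_ac_eq[OF assms(1) A A'(1,2) B]
        lebesgue_decomposition_ac_eq[OF assms(2) A' A(1,2) B]
      by (simp add: Un_commute)
  qed (use sets in simp)
qed

lemma lebesgue_decomposition_absolutely_continuous:
  assumes "absolutely_continuous M N" "sets N = sets M"
  shows "lebesgue_decomposition M N N (null_measure M)"
  using assms
  by (auto simp: lebesgue_decomposition_def mutually_singular_def intro!: bexI[of _ "{}"])

text \<open>The zero set of \<open>w\<close> is null for \<open>density M w\<close> and so supports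
  the singular part. On a null set of \<open>density M w\<close> the weight vanishes
  \<open>M\<close>-almost everywhere, so such a set meets the region \<open>w x \<noteq> 0\<close>
  in an \<open>M\<close>-null set.\<close>

lemma lebesgue_decomposition_wrt_density:
  fixes w :: "'a \<Rightarrow> ennreal"
  assumes [measurable]: "w \<in> borel_measurable M"
  shows "lebesgue_decomposition (density M w) M
    (density M (indicator {x \<in> space M. w x \<noteq> 0})) (density M (indicator {x \<in> space M. w x = 0}))"
    (is "lebesgue_decomposition ?D M (density M (indicator ?P)) (density M (indicator ?Z))")
proof -
  have [measurable]: "?P \<in> sets M" "?Z \<in> sets M" by measurable
  have "absolutely_continuous ?D (density M (indicator ?P))"
    unfolding absolutely_continuous_def
  proof
    fix A assume "A \<in> null_sets ?D"
    then have "A \<in> sets M" "AE x in M. x \<in> A \<longrightarrow> w x = 0"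
      by (simp_all add: null_sets_density_iff)
    then show "A \<in> null_sets (density M (indicator ?P))"
      by (subst null_sets_density_iff) auto
  qed
  moreover have "mutually_singular ?D (density M (indicator ?Z))"
    unfolding mutually_singular_def
  proof (intro bexI conjI)
    have "?Z \<in> null_sets ?D"
      by (subst null_sets_density_iff) auto
    then show "emeasure ?D ?Z = 0" by auto
    have "space M - ?Z \<in> null_sets (density M (indicator ?Z))"
      by (subst null_sets_density_iff) (auto simp: indicator_def)
    then show "emeasure (density M (indicator ?Z)) (space ?D - ?Z) = 0"
      by auto
  qed simp
  moreover have "emeasure M A =
      emeasure (density M (indicator ?P)) A + emeasure (density M (indicator ?Z)) A"
    if [measurable]: "A \<in> sets M" for A
  proof -
    have "emeasure M A = emeasure M ((?P \<inter> A) \<union> (?Z \<inter> A))"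
      using sets.sets_into_space[OF that] by (intro arg_cong[of _ _ "emeasure M"]) auto
    also have "\<dots> = emeasure M (?P \<inter> A) + emeasure M (?Z \<inter> A)"
      by (intro plus_emeasure[symmetric]) auto
    finally show ?thesis
      by (simp add: emeasure_restricted)
  qed
  ultimately show ?thesis
    by (simp add: lebesgue_decomposition_def)
qed

text \<open>The product of \<open>w\<close> and \<open>g\<close> is the indicator of the region
  \<open>w x \<noteq> 0\<close>, and uniqueness identifies the resulting measure with
  \<open>Nac\<close>. The values of \<open>g\<close> on the zero set of \<open>w\<close> are
  free.\<close>

lemma is_RN_deriv_ac_part_wrt_density:
  fixes w g :: "'a \<Rightarrow> ennreal"
  assumes [measurable]: "w \<in> borel_measurable M" "g \<in> borel_measurable M"
    and inverse: "\<And>x. x \<in> space M \<Longrightarrow> w x \<noteq> 0 \<Longrightarrow> w x * g x = 1"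
    and "lebesgue_decomposition (density M w) M Nac Ns"
  shows "is_RN_deriv (density M w) Nac g"
proof -
  have "density (density M w) g = density M (\<lambda>x. w x * g x)"
    by (rule density_density_eq) auto
  also have "\<dots> = density M (indicator {x \<in> space M. w x \<noteq> 0})"
    by (intro density_cong) (auto simp: indicator_def inverse)
  also have "\<dots> = Nac"
    using lebesgue_decomposition_unique[OF lebesgue_decomposition_wrt_density assms(4)] by simp
  finally show ?thesis
    by (simp add: is_RN_deriv_def)
qed

lemma is_RN_deriv_ac_part_density:
  assumes [measurable]: "h \<in> borel_measurable M"
    and "lebesgue_decomposition M (density M h) Nac Ns"
  shows "is_RN_deriv M Nac h"
proof -
  have "lebesgue_decomposition M (density M h) (density M h) (null_measure M)"
    by (intro lebesgue_decomposition_absolutely_continuous absolutely_continuousI_density) auto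
  then have "density M h = Nac"
    using assms(2) by (rule lebesgue_decomposition_unique)
  then show ?thesis
    by (simp add: is_RN_deriv_def)
qed

text \<open>The function \<open>f\<close> is a density of \<open>Nac\<close>, so its integral is the
  total mass of \<open>Nac\<close>, which is what \<open>Ns\<close> leaves of the unit mass of
  \<open>N\<close>. The assumption \<open>deriv\<close> has the form in which the fluctuation
  relation delivers it.\<close>

lemma integral_ac_density:
  fixes f :: "'a \<Rightarrow> real"
  assumes "prob_space M" "prob_space N"
    and dec: "lebesgue_decomposition M N Nac Ns"
    and f: "f \<in> borel_measurable M" "\<And>x. 0 \<le> f x"
    and deriv: "\<And>k. is_RN_deriv M Nac k \<Longrightarrow> AE x in M. k x = ennreal (f x)"
  shows "integrable M f \<and> (\<integral>x. f x \<partial>M) = 1 - measure Ns (space Ns)"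
proof -
  interpret M: prob_space M by fact
  interpret N: prob_space N by fact
  have sets: "sets N = sets M" "sets Nac = sets M" "sets Ns = sets M"
    and ac: "absolutely_continuous M Nac"
    and sum: "\<And>C. C \<in> sets M \<Longrightarrow> emeasure N C = emeasure Nac C + emeasure Ns C"
    using dec by (auto simp: lebesgue_decomposition_def)
  note space = sets[THEN sets_eq_imp_space_eq]
  have total: "emeasure Nac (space M) + emeasure Ns (space M) = 1"
    using sum[of "space M"] N.emeasure_space_1 space by simp
  \<comment> \<open>Radon-Nikodym provides a representative to which \<open>deriv\<close> can be
    applied; without one, \<open>deriv\<close> could hold vacuously.\<close>
  have "is_RN_deriv M Nac (RN_deriv M Nac)"
    using M.density_RN_deriv[OF ac] sets by (simp add: is_RN_deriv_def)
  then have ae: "AE x in M. RN_deriv M Nac x = ennreal (f x)"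
    by (rule deriv)
  have "(\<integral>\<^sup>+x. ennreal (f x) \<partial>M) = (\<integral>\<^sup>+x. RN_deriv M Nac x * indicator (space M) x \<partial>M)"
    using ae by (intro nn_integral_cong_AE) (auto simp: indicator_def)
  also have "\<dots> = emeasure (density M (RN_deriv M Nac)) (space M)"
    by (intro emeasure_density[symmetric]) auto
  also have "density M (RN_deriv M Nac) = Nac"
    using ac sets by (intro M.density_RN_deriv) auto
  finally have nn: "(\<integral>\<^sup>+x. ennreal (f x) \<partial>M) = emeasure Nac (space M)" .
  \<comment> \<open>\<open>measure\<close> is \<open>enn2real\<close> of \<open>emeasure\<close>,
    and \<open>enn2real\<close> sends infinity to 0, so finiteness of both parts is needed for
    additivity.\<close>
  have fin: "emeasure Nac (space M) \<noteq> \<infinity>" "emeasure Ns (space M) \<noteq> \<infinity>"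
    using total by auto
  have "measure Nac (space M) + measure Ns (space M) = 1"
    using total enn2real_plus[of "emeasure Nac (space M)" "emeasure Ns (space M)"] fin
    by (simp add: measure_def less_top)
  moreover have "integrable M f"
    using f nn fin by (intro integrableI_nonneg) (auto simp: less_top)
  moreover have "(\<integral>x. f x \<partial>M) = measure Nac (space M)"
    using f nn by (simp add: integral_eq_nn_integral measure_def)
  ultimately show ?thesis
    using space by simp
qed

theorem mainTheorem3:
  fixes \<Omega> D0 D\<tau> :: "'a::euclidean_space set"
    and \<tau> \<beta> F0 F\<tau> \<Delta>F lambdaS :: real
    and P M Mr Mr_ac Mr_s :: "(real \<Rightarrow> 'a) measure"
    and \<theta> :: "'a \<Rightarrow> 'a"
    and law :: "(real \<Rightarrow> 'l) \<Rightarrow> 'a measure \<Rightarrow> (real \<Rightarrow> 'a) measure"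
    and lam :: "real \<Rightarrow> 'l"
    and H :: "'a \<Rightarrow> 'l \<Rightarrow> real"
    and Q W :: "(real \<Rightarrow> 'a) \<Rightarrow> real"
    and \<mu>L \<mu>L_ac \<mu>L_s \<mu>0 \<mu>d \<mu>d_ac \<mu>d_s :: "'a measure"
  assumes "\<Omega> \<in> sets borel" and "\<mu>L = phase_measure \<Omega>"
    and "0 \<le> \<tau>" and "0 < \<beta>"
    and "path_space \<tau> \<Omega> P"
    and "reversal_involution \<Omega> \<theta>"
    and "reverse_path \<tau> \<theta> \<in> measurable P P"
    and "\<And>l. (\<lambda>x. H x l) \<in> borel_measurable \<mu>L"
    and "Q \<in> borel_measurable P"
    and "W = work \<tau> H lam Q"
    and "D0 \<in> sets \<mu>L" and "D\<tau> \<in> sets \<mu>L"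
    \<comment> \<open>free energies\<close>
    and "0 < partition_function \<Omega> \<beta> (\<lambda>x. H x (lam 0)) D0"
    and "partition_function \<Omega> \<beta> (\<lambda>x. H x (lam 0)) D0 < \<infinity>"
    and "ennreal (exp (- \<beta> * F0)) = partition_function \<Omega> \<beta> (\<lambda>x. H x (lam 0)) D0"
    and "0 < partition_function \<Omega> \<beta> (\<lambda>x. H x (lam \<tau>)) D\<tau>"
    and "partition_function \<Omega> \<beta> (\<lambda>x. H x (lam \<tau>)) D\<tau> < \<infinity>"
    and "ennreal (exp (- \<beta> * F\<tau>)) = partition_function \<Omega> \<beta> (\<lambda>x. H x (lam \<tau>)) D\<tau>"
    and "\<Delta>F = F\<tau> - F0"
    \<comment> \<open>initial distributions\<close>
    and "\<mu>0 = local_equilibrium \<Omega> \<beta> (\<lambda>x. H x (lam 0)) F0 D0"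
    and "\<mu>d = local_equilibrium \<Omega> \<beta> (\<lambda>x. H x (lam \<tau>)) F\<tau> D\<tau>"
    \<comment> \<open>original and time-reversed process\<close>
    and "process_law \<Omega> P \<mu>0 (law lam \<mu>0)"
    and "process_law \<Omega> P (reversed_initial \<Omega> \<theta> \<mu>d)
           (law (reverse_protocol \<tau> lam) (reversed_initial \<Omega> \<theta> \<mu>d))"
    and "M = law lam \<mu>0"
    and "Mr = reversed_law \<tau> \<Omega> P \<theta> law lam \<mu>d"
    \<comment> \<open>Lebesgue decompositions and detailed fluctuation relation\<close>
    and "lebesgue_decomposition M Mr Mr_ac Mr_s"
    and "lambdaS = measure Mr_s (space Mr_s)"
    and "lebesgue_decomposition \<mu>0 \<mu>L \<mu>L_ac \<mu>L_s"
    and "lebesgue_decomposition \<mu>L \<mu>d \<mu>d_ac \<mu>d_s"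
    and "detailed_fluctuation_relation \<tau> \<beta> Q M Mr_ac \<mu>L \<mu>L_ac \<mu>0 \<mu>d_ac"
  shows "(integrable M (\<lambda>\<Gamma>. exp (- \<beta> * (W \<Gamma> - \<Delta>F)) * indicator D\<tau> (\<Gamma> \<tau>)) \<and>
          (\<integral>\<Gamma>. exp (- \<beta> * (W \<Gamma> - \<Delta>F)) * indicator D\<tau> (\<Gamma> \<tau>) \<partial>M) = 1 - lambdaS) \<and>
         (D\<tau> = \<Omega> \<longrightarrow>
          integrable M (\<lambda>\<Gamma>. exp (- \<beta> * (W \<Gamma> - \<Delta>F))) \<and>
          (\<integral>\<Gamma>. exp (- \<beta> * (W \<Gamma> - \<Delta>F)) \<partial>M) = 1 - lambdaS)"
proof -
  have \<tau>: "0 \<in> {0..\<tau>}" "\<tau> \<in> {0..\<tau>}"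
    using assms(3) by auto
  have M: "prob_space M" "sets M = sets P"
    using assms(22,24) by (auto simp: process_law_def)
  have measH: "(\<lambda>x. H x l) \<in> borel_measurable (phase_measure \<Omega>)" for l
    using assms(8)[of l] assms(2) by simp
  have sets_D [measurable]: "D0 \<in> sets (phase_measure \<Omega>)" "D\<tau> \<in> sets (phase_measure \<Omega>)"
    using assms(2,11,12) by auto
  have \<Gamma>0 [measurable]: "(\<lambda>\<Gamma>. \<Gamma> 0) \<in> measurable M (phase_measure \<Omega>)"
    and \<Gamma>\<tau> [measurable]: "(\<lambda>\<Gamma>. \<Gamma> \<tau>) \<in> measurable M (phase_measure \<Omega>)"
    using assms(5) \<tau> by (auto simp: path_space_def measurable_cong_sets[OF M(2) refl])
  have [measurable]: "Q \<in> borel_measurable M"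
    using assms(9) by (simp add: measurable_cong_sets[OF M(2) refl])
  note [measurable] = measH measurable_compose[OF \<Gamma>0 measH] measurable_compose[OF \<Gamma>\<tau> measH]
  have Mr: "prob_space Mr"
    using assms(7,23) unfolding assms(25) reversed_law_def process_law_def
    by (intro prob_space.prob_space_distr) (auto cong: measurable_cong_sets)

  define w where "w = (\<lambda>x. ennreal (exp (- \<beta> * (H x (lam 0) - F0)) * indicator D0 x))"
  \<comment> \<open>\<open>g\<close> carries no indicator of \<open>D0\<close>: off
    \<open>D0\<close> the measure \<open>\<mu>0\<close> has no mass, and with this choice the
    product of the derivatives is exact at every path.\<close>
  define g where "g = (\<lambda>x. ennreal (exp (\<beta> * (H x (lam 0) - F0))))"
  define h where "h = (\<lambda>x. ennreal (exp (- \<beta> * (H x (lam \<tau>) - F\<tau>)) * indicator D\<tau> x))"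
  have [measurable]: "w \<in> borel_measurable (phase_measure \<Omega>)"
    "g \<in> borel_measurable (phase_measure \<Omega>)" "h \<in> borel_measurable (phase_measure \<Omega>)"
    unfolding w_def g_def h_def by measurable
  have \<mu>0: "\<mu>0 = density \<mu>L w" and \<mu>d: "\<mu>d = density \<mu>L h"
    using assms(2,20,21) by (auto simp: local_equilibrium_def w_def h_def)
  \<comment> \<open>The exponential is positive, so \<open>w x \<noteq> 0\<close> forces
    \<open>x\<close> into \<open>D0\<close>, where the two exponents cancel.\<close>
  have "w x * g x = 1" if "w x \<noteq> 0" for x
    using that
    by (auto simp: w_def g_def indicator_def ennreal_mult[symmetric] exp_add[symmetric]
        simp flip: ennreal_1 split: if_splits)
  then have g: "is_RN_deriv \<mu>0 \<mu>L_ac g"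
    using assms(28) unfolding \<mu>0 assms(2)
    by (intro is_RN_deriv_ac_part_wrt_density) auto
  have h: "is_RN_deriv \<mu>L \<mu>d_ac h"
    using assms(29) unfolding \<mu>d assms(2)
    by (intro is_RN_deriv_ac_part_density) auto

  let ?f = "\<lambda>\<Gamma>. exp (- \<beta> * (W \<Gamma> - \<Delta>F)) * indicator D\<tau> (\<Gamma> \<tau>) :: real"
  \<comment> \<open>By the first law the exponents \<open>- \<beta> * Q\<close>,
    \<open>\<beta> * (H - F0)\<close> at time 0 and \<open>- \<beta> * (H - F\<tau>)\<close> at time
    \<open>\<tau>\<close> add up to \<open>- \<beta> * (W - \<Delta>F)\<close>.\<close>
  have product: "ennreal (exp (- \<beta> * Q \<Gamma>)) * g (\<Gamma> 0) * h (\<Gamma> \<tau>) = ennreal (?f \<Gamma>)" for \<Gamma>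
    unfolding g_def h_def assms(10,19) work_def
    by (auto simp: indicator_def ennreal_mult[symmetric] exp_add[symmetric] algebra_simps)
  have main: "integrable M ?f \<and> (\<integral>\<Gamma>. ?f \<Gamma> \<partial>M) = 1 - lambdaS"
    unfolding assms(27)
  proof (rule integral_ac_density[OF M(1) Mr assms(26)])
    show "?f \<in> borel_measurable M"
      unfolding assms(10) work_def by measurable
    show "AE \<Gamma> in M. k \<Gamma> = ennreal (?f \<Gamma>)" if "is_RN_deriv M Mr_ac k" for k
      \<comment> \<open>The fluctuation relation covers all representatives, so it may be evaluated
        with the explicit \<open>g\<close> and \<open>h\<close>, whatever the law of
        \<open>\<Gamma> \<tau>\<close>.\<close>
      using assms(30) that g h unfolding detailed_fluctuation_relation_def product[symmetric] by blast
  qed simp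
  \<comment> \<open>Paths in \<open>space M\<close> end in \<open>\<Omega>\<close>, so the indicator
    is 1 there; this suffices for the congruence rules of the integral.\<close>
  have whole: "?f \<Gamma> = exp (- \<beta> * (W \<Gamma> - \<Delta>F))" if "D\<tau> = \<Omega>" "\<Gamma> \<in> space M" for \<Gamma>
    using measurable_space[OF \<Gamma>\<tau> that(2)] that(1)
    by (simp add: phase_measure_def space_restrict_space)
  show ?thesis
  proof (intro conjI[OF main] impI)
    assume D: "D\<tau> = \<Omega>"
    have "integrable M ?f \<longleftrightarrow> integrable M (\<lambda>\<Gamma>. exp (- \<beta> * (W \<Gamma> - \<Delta>F)))"
      by (rule Bochner_Integration.integrable_cong[OF refl whole[OF D]])
    moreover have "(\<integral>\<Gamma>. ?f \<Gamma> \<partial>M) = (\<integral>\<Gamma>. exp (- \<beta> * (W \<Gamma> - \<Delta>F)) \<partial>M)"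
      by (rule Bochner_Integration.integral_cong[OF refl whole[OF D]])
    ultimately show "integrable M (\<lambda>\<Gamma>. exp (- \<beta> * (W \<Gamma> - \<Delta>F))) \<and>
        (\<integral>\<Gamma>. exp (- \<beta> * (W \<Gamma> - \<Delta>F)) \<partial>M) = 1 - lambdaS"
      using main by simp
  qed
qed

end
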